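(* Let $[N]=\{1,\dots,N\}$ be partitioned into $M\ge 2$ disjoint nonempty groups $\mathcal G_1,\dots,\mathcal G_M$, let $a,b\in\mathbb R$, and let $\{1,\dots,M\}=\mathcal G^{(0)}\cup\mathcal G^{(\pi)}$ be a partition of the set of group labels into two disjoint nonempty sets. Put $c_m=0$ if $m\in\mathcal G^{(0)}$ and $c_m=\pi$ if $m\in\mathcal G^{(\pi)}$. Let $\kappa_{ij}=a$ if $i,j$ belong to the same group (including $i=j$) and $\kappa_{ij}=b$ otherwise, and define $A\in\mathbb R^{N\times N}$ by $A_{ij}=\kappa_{ij}\cos(c_m-c_\ell)$ for $i\in\mathcal G_m$, $j\in\mathcal G_\ell$ (so $A_{ii}=a$, and for $i,j$ in different groups $A_{ij}=b$ if the labels of their groups lie in the same one of $\mathcal G^{(0)},\mathcal G^{(\pi)}$ and $A_{ij}=-b$ otherwise). Let $D_A$ be the diagonal matrix with $(D_A)_{ii}=\sum_{j=1}^N A_{ij}$ and let $L=D_A-A$. Then the eigenvalues of $L$, listed with multiplicity, are: \begin{itemize} \item $\lambda=0$ with multiplicity $1$; \item $\lambda=-bN$ with multiplicity $1$; \item for each $x\in\{0,\pi\}$, $\lambda=b\Big(2\sum_{m\in\mathcal G^{(x)}}|\mathcal G_m|-N\Big)$ with multiplicity $|\mathcal G^{(x)}|-1$, where $|\mathcal G^{(x)}|$ is the number of group labels in $\mathcal G^{(x)}$; \item for each $m\in\{1,\dots,M\}$, $\lambda=(a-b)|\mathcal G_m|+b\Big(\sum_{\tilde m\in\mathcal G^{(0)}}|\mathcal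 G_{\tilde m}|-\sum_{\tilde m\in\mathcal G^{(\pi)}}|\mathcal G_{\tilde m}|\Big)\big(2\,\mathbf 1_{\mathcal G^{(0)}}(m)-1\big)$ with multiplicity $|\mathcal G_m|-1$. \end{itemize}
   Context: $\mathbf 1_{\mathcal G^{(0)}}(m)$ equals $1$ if $m\in\mathcal G^{(0)}$ and $0$ otherwise. The list describes the full spectrum of $L$ as a multiset of $N$ numbers: if values from different lines coincide, their multiplicities add up. An entry with multiplicity $0$ is absent. *)

theory Defs
  imports Complex_Main "Jordan_Normal_Form.Char_Poly" "HOL-Library.Disjoint_Sets"
begin

definition group_label :: "nat \<Rightarrow> (nat \<Rightarrow> nat set) \<Rightarrow> nat \<Rightarrow> nat" where
  "group_label M G i = (THE m. m \<in> {1..M} \<and> i \<in> G m)"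

(* The second class of labels does not occur here: it is the complement of G0 in {1..M}. *)
definition phase :: "nat set \<Rightarrow> nat \<Rightarrow> real" where
  "phase G0 m = (if m \<in> G0 then 0 else pi)"

definition coupling :: "nat \<Rightarrow> (nat \<Rightarrow> nat set) \<Rightarrow> real \<Rightarrow> real \<Rightarrow> nat \<Rightarrow> nat \<Rightarrow> real" where
  "coupling M G a b i j = (if \<exists>m\<in>{1..M}. i \<in> G m \<and> j \<in> G m then a else b)"

definition network_entry ::
  "nat \<Rightarrow> (nat \<Rightarrow> nat set) \<Rightarrow> nat set \<Rightarrow> real \<Rightarrow> real \<Rightarrow> nat \<Rightarrow> nat \<Rightarrow> real" where
  "network_entry M G G0 a b i j =
     coupling M G a b i j * cos (phase G0 (group_label M G i) - phase G0 (group_label M G j))"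

(* Nodes are numbered 1, ..., N, matrix rows and columns 0, ..., N - 1; hence the shift by Suc. *)
definition network_mat ::
  "nat \<Rightarrow> nat \<Rightarrow> (nat \<Rightarrow> nat set) \<Rightarrow> nat set \<Rightarrow> real \<Rightarrow> real \<Rightarrow> real mat" where
  "network_mat N M G G0 a b = mat N N (\<lambda>(i, j). network_entry M G G0 a b (Suc i) (Suc j))"

definition row_sum_mat :: "real mat \<Rightarrow> real mat" where
  "row_sum_mat A = mat_diag (dim_row A) (\<lambda>i. \<Sum>j<dim_col A. A $$ (i, j))"

definition laplacian :: "real mat \<Rightarrow> real mat" where
  "laplacian A = row_sum_mat A - A"

(* Eigenvalues with algebraic multiplicity.  Only real eigenvalues are recorded; if the size of
   the multiset is the dimension of A (as for symmetric A), these are all complex eigenvalues. *)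
definition eigenvalue_mset :: "real mat \<Rightarrow> real multiset" where
  "eigenvalue_mset A = proots (char_poly A)"

lemma group_label_eq:
  assumes "disjoint_family_on G {1..M}" "m \<in> {1..M}" "i \<in> G m"
  shows "group_label M G i = m"
  unfolding group_label_def
proof (rule the_equality)
  fix k assume "k \<in> {1..M} \<and> i \<in> G k"
  then show "k = m"
    using assms unfolding disjoint_family_on_def by blast
qed (use assms in simp)

lemma network_entry_same_group:
  assumes "m \<in> {1..M}" "i \<in> G m" "j \<in> G m" "disjoint_family_on G {1..M}"
  shows "network_entry M G G0 a b i j = a"
proof -
  have "\<exists>k\<in>{1..M}. i \<in> G k \<and> j \<in> G k"
    using assms by blast
  then show ?thesis
    using assms by (simp add: network_entry_def coupling_def group_label_eq)
qed

lemma network_entry_different_groups: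
  assumes "disjoint_family_on G {1..M}" "m \<in> {1..M}" "l \<in> {1..M}" "m \<noteq> l" "i \<in> G m" "j \<in> G l"
  shows "network_entry M G G0 a b i j = (if m \<in> G0 \<longleftrightarrow> l \<in> G0 then b else - b)"
proof -
  have "coupling M G a b i j = b"
    unfolding coupling_def
    using assms group_label_eq by metis
  then show ?thesis
    using assms by (simp add: network_entry_def group_label_eq phase_def)
qed

end

theory Submission
  imports Defs
begin

(* Write s k = 1 or -1 for the two classes of labels, n k for the group sizes and S for the signed
   sum of the n k.  Then x I - L is the diagonal matrix with entries
   x - (a - b) n k - b (s k) S, plus (a - b) times the sum over k of the rank-one matrices
   1_k 1_k^T of the group indicators, plus b s s^T.  For all but finitely many x, the determinant
   follows by adding these rank-one terms one at a time, because at every step the added vector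
   has an explicit preimage under the current matrix.  The characteristic polynomial is thus
   known at infinitely many points. *)

section \<open>Determinants under rank-one updates\<close>

text \<open>The unit lower triangular block matrix \<open>?L\<close> satisfies
  \<open>?L * ?X = ?Y * ?L\<close>, where \<open>?X\<close> and \<open>?Y\<close> are block upper
  triangular with determinants det(1 + U V) and det(1 + V U). Since det \<open>?L\<close> is 1, the
  two agree, and the second is the determinant of a 1 x 1 matrix.\<close>

lemma det_one_plus_outer_product:
  fixes u v :: "nat \<Rightarrow> 'a :: idom"
  shows "det (mat n n (\<lambda>(i, j). of_bool (i = j) + u i * v j)) = 1 + (\<Sum>i<n. u i * v i)"
proof -
  define U where "U = mat n 1 (\<lambda>(i, j). u i)"
  define V where "V = mat 1 n (\<lambda>(i, j). v j)"
  have U: "U \<in> carrier_mat n 1" and V: "V \<in> carrier_mat 1 n"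
    by (auto simp: U_def V_def)
  let ?L = "four_block_mat (1\<^sub>m n) (0\<^sub>m n 1) V (1\<^sub>m 1)"
  let ?X = "four_block_mat (1\<^sub>m n + U * V) U (0\<^sub>m 1 n) (1\<^sub>m 1)"
  let ?Y = "four_block_mat (1\<^sub>m n) U (0\<^sub>m 1 n) (1\<^sub>m 1 + V * U)"
  have dims: "?L \<in> carrier_mat (n + 1) (n + 1)" "?X \<in> carrier_mat (n + 1) (n + 1)"
    "?Y \<in> carrier_mat (n + 1) (n + 1)"
    using U V by auto
  have "?L * ?X = four_block_mat (1\<^sub>m n + U * V) U (V * (1\<^sub>m n + U * V)) (V * U + 1\<^sub>m 1)"
    using U V by (subst mult_four_block_mat[of _ n n _ 1 _ 1 _ _ n _ 1]) auto
  also have "V * (1\<^sub>m n + U * V) = V + V * U * V"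
    using U V by (simp add: mult_add_distrib_mat[of _ 1 n _ n] assoc_mult_mat[of _ 1 n _ 1 _ n])
  also have "four_block_mat (1\<^sub>m n + U * V) U (V + V * U * V) (V * U + 1\<^sub>m 1) = ?Y * ?L"
  proof -
    have "(1\<^sub>m 1 + V * U) * V = V + V * U * V"
      using U V by (simp add: add_mult_distrib_mat[of _ 1 1])
    moreover have "V * U + 1\<^sub>m 1 = 1\<^sub>m 1 + V * U"
      using U V by (intro comm_add_mat) auto
    ultimately show ?thesis
      using U V by (subst mult_four_block_mat[of _ n n _ 1 _ 1 _ _ n _ 1]) auto
  qed
  finally have "det (?L * ?X) = det (?Y * ?L)"
    by simp
  moreover have "det ?L = 1"
    using V by (subst det_four_block_mat_upper_right_zero) auto
  moreover have "det ?X = det (1\<^sub>m n + U * V)"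
    using U V by (subst det_four_block_mat_lower_left_zero[of _ n _ 1]) auto
  moreover have "det ?Y = det (1\<^sub>m 1 + V * U)"
    using U V by (subst det_four_block_mat_lower_left_zero[of _ n _ 1]) auto
  ultimately have "det (1\<^sub>m n + U * V) = det (1\<^sub>m 1 + V * U)"
    using dims by (simp add: det_mult)
  moreover have "1\<^sub>m n + U * V = mat n n (\<lambda>(i, j). of_bool (i = j) + u i * v j)"
    by (rule eq_matI) (auto simp: U_def V_def scalar_prod_def)
  moreover have "det (1\<^sub>m 1 + V * U) = 1 + (\<Sum>i<n. u i * v i)"
    by (subst det_single)
       (auto simp: U_def V_def scalar_prod_def atLeast0LessThan mult.commute)
  ultimately show ?thesis
    by simp
qed

text \<open>With \<open>w\<close> in the role of B^{-1} u, the updated matrix factors as B (I + w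
  v^T), and the second factor has a known determinant.\<close>

lemma det_rank_one_update:
  fixes u v w :: "nat \<Rightarrow> 'a :: idom"
  assumes B: "B \<in> carrier_mat n n"
    and preimage: "\<And>i. i < n \<Longrightarrow> (\<Sum>j<n. B $$ (i, j) * w j) = u i"
  shows "det (mat n n (\<lambda>(i, j). B $$ (i, j) + u i * v j)) = det B * (1 + (\<Sum>i<n. w i * v i))"
proof -
  let ?E = "mat n n (\<lambda>(i, j). of_bool (i = j) + w i * v j)"
  have "mat n n (\<lambda>(i, j). B $$ (i, j) + u i * v j) = B * ?E"
  proof (rule eq_matI)
    fix i j assume "i < dim_row (B * ?E)" and "j < dim_col (B * ?E)"
    with B have i: "i < n" and j: "j < n"
      by auto
    have "(B * ?E) $$ (i, j) = (\<Sum>k<n. B $$ (i, k) * (of_bool (k = j) + w k * v j))"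
      using B i j by (simp add: scalar_prod_def atLeast0LessThan)
    also have "\<dots> = (\<Sum>k<n. B $$ (i, k) * of_bool (k = j)) + (\<Sum>k<n. B $$ (i, k) * w k) * v j"
      by (simp add: distrib_left sum.distrib sum_distrib_right mult.assoc)
    also have "(\<Sum>k<n. B $$ (i, k) * of_bool (k = j)) = (\<Sum>k<n. if k = j then B $$ (i, k) else 0)"
      by (intro sum.cong) auto
    also have "\<dots> + (\<Sum>k<n. B $$ (i, k) * w k) * v j = B $$ (i, j) + u i * v j"
      using i j by (simp add: preimage)
    finally show "mat n n (\<lambda>(i, j). B $$ (i, j) + u i * v j) $$ (i, j) = (B * ?E) $$ (i, j)"
      using i j by simp
  qed (use B in auto)
  then show ?thesis
    using B by (simp add: det_mult[of _ n] det_one_plus_outer_product)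
qed

text \<open>\<open>g\<close> assigns indices to blocks, and \<open>K\<close> collects the blocks
  already filled with \<open>c\<close>. Filling one more block \<open>k\<close> adds c 1_k 1_k^T.
  The current matrix is still diagonal on that block, so (c / d k) 1_k is a preimage of c
  1_k.\<close>

lemma det_diagonal_plus_blocks:
  fixes d :: "'b \<Rightarrow> 'a :: field" and g :: "nat \<Rightarrow> 'b"
  assumes "finite K" "\<And>k. k \<in> K \<Longrightarrow> d k \<noteq> 0"
  shows "det (mat n n (\<lambda>(i, j). of_bool (i = j) * d (g i) + of_bool (g i = g j \<and> g i \<in> K) * c)) =
    (\<Prod>i<n. d (g i)) * (\<Prod>k\<in>K. 1 + c * of_nat (card {i. i < n \<and> g i = k}) / d k)"
  using assms
proof (induction K rule: finite_induct)
  case empty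
  have "det (mat n n (\<lambda>(i, j). of_bool (i = j) * d (g i))) =
      prod_list (diag_mat (mat n n (\<lambda>(i, j). of_bool (i = j) * d (g i))))"
    by (rule det_upper_triangular[of _ n]) auto
  also have "\<dots> = (\<Prod>i<n. d (g i))"
    by (simp add: prod_list_diag_prod atLeast0LessThan)
  finally show ?case
    by simp
next
  case (insert k K)
  let ?entry = "\<lambda>K i j. of_bool (i = j) * d (g i) + of_bool (g i = g j \<and> g i \<in> K) * c"
  let ?B = "mat n n (\<lambda>(i, j). ?entry K i j)"
  let ?u = "\<lambda>i. of_bool (g i = k) * c"
  let ?v = "\<lambda>j. of_bool (g j = k) :: 'a"
  let ?w = "\<lambda>j. of_bool (g j = k) * c / d k"
  have "mat n n (\<lambda>(i, j). ?entry (insert k K) i j) = mat n n (\<lambda>(i, j). ?B $$ (i, j) + ?u i * ?v j)"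
    using insert.hyps by (intro cong_mat) auto
  also have "det \<dots> = det ?B * (1 + (\<Sum>i<n. ?w i * ?v i))"
  proof (rule det_rank_one_update)
    fix i assume i: "i < n"
    \<comment> \<open>Only the diagonal term survives: if \<open>g i = k\<close>, row
      \<open>i\<close> has no block part because \<open>k\<close> is not in \<open>K\<close>;
      otherwise \<open>?w\<close> vanishes on the block of \<open>i\<close>.\<close>
    have "(\<Sum>j<n. ?B $$ (i, j) * ?w j) = (\<Sum>j<n. if i = j then d (g i) * ?w i else 0)"
      using i insert.hyps by (intro sum.cong) auto
    also have "\<dots> = ?u i"
      using i insert.prems by auto
    finally show "(\<Sum>j<n. ?B $$ (i, j) * ?w j) = ?u i" .
  qed simp
  also have "(\<Sum>i<n. ?w i * ?v i) = (\<Sum>i\<in>{i. i < n \<and> g i = k}. c / d k)"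
    by (rule sum.mono_neutral_cong_right) auto
  finally show ?case
    using insert by simp
qed

text \<open>The diagonal-plus-blocks matrix maps the indicator of block \<open>k\<close> to
  \<open>e k\<close> times itself. Hence c' s has the preimage c' s / e, constant on each block, and
  one more rank-one update applies.\<close>

lemma det_diagonal_plus_blocks_plus_rank_one:
  fixes d s :: "'b \<Rightarrow> 'a :: field" and g :: "nat \<Rightarrow> 'b"
  assumes K: "finite K" "g ` {..<n} = K"
    and nk: "\<And>k. k \<in> K \<Longrightarrow> nk k = card {i. i < n \<and> g i = k}"
    and e: "\<And>k. k \<in> K \<Longrightarrow> e k = d k + c * of_nat (nk k)"
    and nz: "\<And>k. k \<in> K \<Longrightarrow> d k \<noteq> 0" "\<And>k. k \<in> K \<Longrightarrow> e k \<noteq> 0"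
  shows "det (mat n n (\<lambda>(i, j).
      of_bool (i = j) * d (g i) + of_bool (g i = g j) * c + c' * s (g i) * s (g j))) =
    (\<Prod>k\<in>K. d k ^ (nk k - 1)) * (\<Prod>k\<in>K. e k) *
    (1 + c' * (\<Sum>k\<in>K. of_nat (nk k) * (s k)\<^sup>2 / e k))"
proof -
  let ?B = "mat n n (\<lambda>(i, j). of_bool (i = j) * d (g i) + of_bool (g i = g j \<and> g i \<in> K) * c)"
  have gK: "g i \<in> K" if "i < n" for i
    using K that by auto
  have nk_pos: "nk k > 0" if "k \<in> K" for k
    using that K nk by (auto simp: card_gt_0_iff)
  have "mat n n (\<lambda>(i, j). of_bool (i = j) * d (g i) + of_bool (g i = g j) * c + c' * s (g i) * s (g j))
      = mat n n (\<lambda>(i, j). ?B $$ (i, j) + c' * s (g i) * s (g j))"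
    using gK by (intro cong_mat) auto
  also have "det \<dots> = det ?B * (1 + (\<Sum>i<n. c' * s (g i) / e (g i) * s (g i)))"
  proof (rule det_rank_one_update)
    fix i assume i: "i < n"
    define w where "w k = c' * s k / e k" for k
    have "(\<Sum>j<n. ?B $$ (i, j) * w (g j)) =
        (\<Sum>j<n. (if i = j then d (g i) * w (g i) else 0) + (if g j = g i then c * w (g i) else 0))"
      using i gK by (intro sum.cong) (auto simp: algebra_simps)
    also have "\<dots> = d (g i) * w (g i) + (\<Sum>j\<in>{j. j < n \<and> g j = g i}. c * w (g i))"
      using i by (simp add: sum.distrib sum.inter_filter[symmetric])
    also have "\<dots> = e (g i) * w (g i)"
      using e[OF gK[OF i]] nk[OF gK[OF i]] by (simp add: algebra_simps)
    also have "\<dots> = c' * s (g i)"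
      using nz gK[OF i] by (simp add: w_def)
    finally show "(\<Sum>j<n. ?B $$ (i, j) * (c' * s (g j) / e (g j))) = c' * s (g i)"
      by (simp only: w_def)
  qed simp
  also have "(\<Sum>i<n. c' * s (g i) / e (g i) * s (g i)) =
      (\<Sum>k\<in>K. \<Sum>i\<in>{i. i \<in> {..<n} \<and> g i = k}. c' * s (g i) / e (g i) * s (g i))"
    using K by (subst sum.group) auto
  also have "\<dots> = c' * (\<Sum>k\<in>K. of_nat (nk k) * (s k)\<^sup>2 / e k)"
    by (auto simp: sum_distrib_left nk power2_eq_square intro!: sum.cong)
  also have "det ?B = (\<Prod>i<n. d (g i)) * (\<Prod>k\<in>K. 1 + c * of_nat (nk k) / d k)"
    using det_diagonal_plus_blocks[of K d n g c] K nz nk by simp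
  also have "(\<Prod>i<n. d (g i)) = (\<Prod>k\<in>K. \<Prod>i\<in>{i. i \<in> {..<n} \<and> g i = k}. d (g i))"
    using K by (subst prod.group) auto
  also have "\<dots> = (\<Prod>k\<in>K. d k ^ nk k)"
    by (auto simp: nk intro!: prod.cong)
  \<comment> \<open>Every block is nonempty, as \<open>g\<close> maps onto \<open>K\<close>, so one
    factor \<open>d k\<close> can be split off to clear the denominator in 1 + c n / d, leaving
    \<open>e k\<close>.\<close>
  also have "(\<Prod>k\<in>K. d k ^ nk k) * (\<Prod>k\<in>K. 1 + c * of_nat (nk k) / d k) =
      (\<Prod>k\<in>K. d k ^ (nk k - 1)) * (\<Prod>k\<in>K. e k)"
    unfolding prod.distrib[symmetric]
  proof (rule prod.cong[OF refl])
    fix k assume k: "k \<in> K"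
    have "d k ^ nk k = d k ^ (nk k - 1) * d k"
      using nk_pos[OF k] by (metis Suc_diff_1 power_Suc2)
    then show "d k ^ nk k * (1 + c * of_nat (nk k) / d k) = d k ^ (nk k - 1) * e k"
      using nz(1)[OF k] e[OF k] by (simp add: field_simps)
  qed
  finally show ?thesis .
qed

section \<open>Polynomials from their values and from their roots\<close>

text \<open>A nonzero difference would have finitely many roots, while the complement of a finite
  set is infinite in characteristic 0. This permits excluding the points where a denominator
  vanishes.\<close>

lemma poly_eqI_cofinite:
  fixes p q :: "'a :: {idom, ring_char_0} poly"
  assumes "finite X" "\<And>x. x \<notin> X \<Longrightarrow> poly p x = poly q x"
  shows "p = q"
proof (rule ccontr)
  assume "p \<noteq> q"
  then have "finite {x. poly (p - q) x = 0}"
    by (intro poly_roots_finite) simp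
  moreover have "- X \<subseteq> {x. poly (p - q) x = 0}"
    using assms(2) by auto
  ultimately have "finite (X \<union> - X)"
    using assms(1) finite_subset by blast
  then show False
    by (simp add: infinite_UNIV_char_0)
qed

text \<open>Lets the eigenvalue multiset be read off from a complete factorisation of the
  characteristic polynomial.\<close>

lemma proots_prod_mset_linear_factors:
  fixes R :: "'a :: idom multiset"
  shows "proots (\<Prod>r\<in>#R. [:- r, 1:]) = R"
proof (induction R)
  case (add r R)
  have "(\<Prod>r\<in>#R. [:- r, 1:]) \<noteq> 0"
    by auto
  then show ?case
    using add by (simp add: proots_mult del: mult_pCons_left)
qed simp

lemma prod_mset_image_sum:
  "(\<Prod>x\<in>#(\<Sum>k\<in>K. R k). f x) = (\<Prod>k\<in>K. \<Prod>x\<in>#R k. (f x :: 'a :: comm_monoid_mult))"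
  by (induction K rule: infinite_finite_induct) auto

theorem proposition3p2:
  fixes N M :: nat and G :: "nat \<Rightarrow> nat set" and G0 Gpi :: "nat set" and a b :: real
  assumes "M \<ge> 2"
    and "disjoint_family_on G {1..M}"
    and "(\<Union>m\<in>{1..M}. G m) = {1..N}"
    and "\<forall>m\<in>{1..M}. G m \<noteq> {}"
    and "G0 \<union> Gpi = {1..M}"
    and "G0 \<inter> Gpi = {}"
    and "G0 \<noteq> {}"
    and "Gpi \<noteq> {}"
  shows "eigenvalue_mset (laplacian (network_mat N M G G0 a b)) =
      {#0#} + {#- b * real N#}
    + (\<Sum>X\<in>{G0, Gpi}.
         replicate_mset (card X - 1) (b * (2 * (\<Sum>m\<in>X. real (card (G m))) - real N)))
    + (\<Sum>m\<in>{1..M}.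
         replicate_mset (card (G m) - 1)
           ((a - b) * real (card (G m))
            + b * ((\<Sum>k\<in>G0. real (card (G k))) - (\<Sum>k\<in>Gpi. real (card (G k))))
                * (2 * of_bool (m \<in> G0) - 1)))"
    (is "_ = ?R")
proof -
  let ?K = "{1..M}"
  define g where "g i = group_label M G (Suc i)" for i
  define s :: "nat \<Rightarrow> real" where "s k = 2 * of_bool (k \<in> G0) - 1" for k
  define n where "n k = card (G k)" for k
  define P where "P = (\<Sum>k\<in>G0. real (n k))"
  define Q where "Q = (\<Sum>k\<in>Gpi. real (n k))"
  \<comment> \<open>This is both the row sum of the network matrix at a node of group
    \<open>k\<close> and the eigenvalue on zero-sum vectors supported on that group, which the
    network matrix annihilates.\<close>
  define ev where "ev k = (a - b) * real (n k) + b * (P - Q) * s k" for k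
  define L where "L = laplacian (network_mat N M G G0 a b)"

  \<comment> \<open>Groups and class sums in zero-based indices\<close>
  have label: "g i \<in> ?K" "Suc i \<in> G (g i)" if "i < N" for i
  proof -
    have "Suc i \<in> (\<Union>m\<in>?K. G m)"
      using assms(3) that by auto
    then obtain m where m: "m \<in> ?K" "Suc i \<in> G m"
      by blast
    then have "g i = m"
      using assms(2) by (simp add: g_def group_label_eq)
    then show "g i \<in> ?K" "Suc i \<in> G (g i)"
      using m by simp_all
  qed
  have g_eq_iff: "g i = k \<longleftrightarrow> Suc i \<in> G k" if "i < N" "k \<in> ?K" for i k
    using that assms(2) label by (auto simp: g_def group_label_eq)
  have group: "Suc ` {i. i < N \<and> g i = k} = G k" if "k \<in> ?K" for k
  proof
    show "Suc ` {i. i < N \<and> g i = k} \<subseteq> G k"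
      using label by auto
    show "G k \<subseteq> Suc ` {i. i < N \<and> g i = k}"
    proof
      fix x assume x: "x \<in> G k"
      then have "x \<in> {1..N}"
        using assms(3) that by blast
      then obtain i where "x = Suc i" "i < N"
        by (cases x) auto
      then show "x \<in> Suc ` {i. i < N \<and> g i = k}"
        using x g_eq_iff that by auto
    qed
  qed
  have n_eq: "n k = card {i. i < N \<and> g i = k}" if "k \<in> ?K" for k
    using group[OF that] by (metis card_image inj_Suc n_def inj_on_subset subset_UNIV)
  have g_image: "g ` {..<N} = ?K"
  proof
    show "?K \<subseteq> g ` {..<N}"
    proof
      fix k assume k: "k \<in> ?K"
      then have "Suc ` {i. i < N \<and> g i = k} \<noteq> {}"
        using group assms(4) by simp
      then show "k \<in> g ` {..<N}"
        by auto
    qed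
  qed (use label in auto)

  have fin: "finite G0" "finite Gpi"
    using assms(5) by (metis finite_Un finite_atLeastAtMost)+
  have sum_split: "(\<Sum>k\<in>?K. f k) = (\<Sum>k\<in>G0. f k) + (\<Sum>k\<in>Gpi. f k)" for f :: "nat \<Rightarrow> real"
    unfolding assms(5)[symmetric] using fin assms(6) by (rule sum.union_disjoint)
  have s0: "s k = 1" if "k \<in> G0" for k
    using that by (simp add: s_def)
  have spi: "s k = -1" if "k \<in> Gpi" for k
    using that assms(6) by (auto simp: s_def)
  have s_square: "s k * s k = 1" for k
    by (simp add: s_def)
  have group_sum: "(\<Sum>i<N. f (g i)) = (\<Sum>k\<in>?K. real (n k) * f k)" for f :: "nat \<Rightarrow> real"
  proof -
    have "(\<Sum>i<N. f (g i)) = (\<Sum>k\<in>?K. \<Sum>i\<in>{i. i \<in> {..<N} \<and> g i = k}. f (g i))"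
      using g_image by (subst sum.group) auto
    also have "\<dots> = (\<Sum>k\<in>?K. real (n k) * f k)"
      by (intro sum.cong) (auto simp: n_eq)
    finally show ?thesis .
  qed
  have N: "real N = P + Q"
    using group_sum[of "\<lambda>_. 1"] sum_split[of "\<lambda>k. real (n k)"] by (simp add: P_def Q_def)

  \<comment> \<open>Entries and row sums of the Laplacian\<close>
  \<comment> \<open>The cosine of a phase difference is the product of the signs \<open>s\<close>.
    Within a group this product is 1, so the correction \<open>a - b\<close> restores the value
    \<open>a\<close>.\<close>
  have entry: "network_entry M G G0 a b (Suc i) (Suc j) =
      of_bool (g i = g j) * (a - b) + b * s (g i) * s (g j)" if "i < N" "j < N" for i j
  proof (cases "g i = g j")
    case True
    then show ?thesis
      using that label[of i] label[of j] assms(2) s_square[of "g j"]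
        network_entry_same_group[of "g i" M "Suc i" G "Suc j" G0 a b]
      by (simp add: mult.assoc)
  next
    case False
    then show ?thesis
      using that label[of i] label[of j] assms(2)
        network_entry_different_groups[of G M "g i" "g j" "Suc i" "Suc j" G0 a b]
      by (simp add: s_def)
  qed
  have row_sum: "(\<Sum>j<N. network_entry M G G0 a b (Suc i) (Suc j)) = ev (g i)" if i: "i < N" for i
  proof -
    have "(\<Sum>j<N. network_entry M G G0 a b (Suc i) (Suc j)) =
        (\<Sum>k\<in>?K. real (n k) * (of_bool (g i = k) * (a - b) + b * s (g i) * s k))"
      using entry[OF i]
        group_sum[of "\<lambda>k. of_bool (g i = k) * (a - b) + b * s (g i) * s k"] by simp
    also have "\<dots> = (\<Sum>k\<in>?K. if g i = k then (a - b) * real (n k) else 0)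
        + b * s (g i) * (\<Sum>k\<in>?K. real (n k) * s k)"
      unfolding sum_distrib_left sum.distrib[symmetric]
      by (intro sum.cong) (auto simp: algebra_simps)
    also have "(\<Sum>k\<in>?K. real (n k) * s k) = P - Q"
      unfolding sum_split by (simp add: s0 spi P_def Q_def sum_negf)
    finally show ?thesis
      using label(1)[OF i] by (simp add: ev_def)
  qed
  have L: "L \<in> carrier_mat N N"
    unfolding L_def laplacian_def by (rule minus_carrier_mat) (simp add: network_mat_def)
  have L_entry: "L $$ (i, j) = of_bool (i = j) * ev (g i) - network_entry M G G0 a b (Suc i) (Suc j)"
    if "i < N" "j < N" for i j
    using that row_sum
    by (simp add: L_def laplacian_def row_sum_mat_def network_mat_def mat_diag_def)

  \<comment> \<open>The characteristic polynomial away from finitely many points\<close>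
  have spectrum: "?R = {#0#} + {#- b * real N#}
    + (replicate_mset (card G0 - 1) (b * (P - Q)) + replicate_mset (card Gpi - 1) (- b * (P - Q)))
    + (\<Sum>k\<in>?K. replicate_mset (n k - 1) (ev k))"
  proof -
    \<comment> \<open>The sum over the set \<open>{G0, Gpi}\<close> has two terms only when the
      classes differ; this follows as they are disjoint and \<open>G0\<close> is nonempty.\<close>
    have "G0 \<noteq> Gpi"
      using assms(6,7) by auto
    have eqs: "2 * P - real N = P - Q" "2 * Q - real N = - (P - Q)"
      by (simp_all add: N)
    from \<open>G0 \<noteq> Gpi\<close> show ?thesis
      by (simp add: eqs ev_def s_def del: minus_diff_eq flip: n_def P_def Q_def)
  qed
  \<comment> \<open>The zeros of all denominators that occur: the values \<open>x - ev k\<close> and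
    the two values of \<open>e\<close> below.\<close>
  let ?X = "insert (b * (P - Q)) (insert (- b * (P - Q)) (ev ` ?K))"
  have char_poly_L: "poly (char_poly L) x = poly (\<Prod>r\<in>#?R. [:- r, 1:]) x"
    if "x \<notin> ?X" for x
  proof -
    \<comment> \<open>This equals \<open>(x - ev k) + (a - b) * n k\<close>: the group size cancels,
      so \<open>e k\<close> depends only on the class of \<open>k\<close>. These repeated values
      produce the multiplicities \<open>card G0 - 1\<close> and \<open>card Gpi - 1\<close>.\<close>
    define e where "e k = x - b * (P - Q) * s k" for k
    have e0: "e k = x - b * (P - Q)" if "k \<in> G0" for k
      using that by (simp add: e_def s0)
    have epi: "e k = x + b * (P - Q)" if "k \<in> Gpi" for k
      using that by (simp add: e_def spi)
    have nz0: "x - b * (P - Q) \<noteq> 0" and nzpi: "x + b * (P - Q) \<noteq> 0"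
      using that by (auto simp: algebra_simps)
    have e_nz: "e k \<noteq> 0" if "k \<in> ?K" for k
      using that assms(5) nz0 nzpi by (metis Un_iff e0 epi)

    have "poly (char_poly L) x = det (- char_matrix L x)"
      using L by (rule char_poly_matrix)
    also have "- char_matrix L x = mat N N (\<lambda>(i, j).
        of_bool (i = j) * (x - ev (g i)) + of_bool (g i = g j) * (a - b) + b * s (g i) * s (g j))"
      by (rule eq_matI)
         (use L in \<open>auto simp: char_matrix_def L_entry entry algebra_simps\<close>)
    also have "det \<dots> = (\<Prod>k\<in>?K. (x - ev k) ^ (n k - 1)) * (\<Prod>k\<in>?K. e k) *
        (1 + b * (\<Sum>k\<in>?K. real (n k) * (s k)\<^sup>2 / e k))"
      by (rule det_diagonal_plus_blocks_plus_rank_one)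
         (use that g_image n_eq e_nz in \<open>auto simp: e_def ev_def\<close>)
    also have "(\<Sum>k\<in>?K. real (n k) * (s k)\<^sup>2 / e k) = P / (x - b * (P - Q)) + Q / (x + b * (P - Q))"
      unfolding sum_split by (simp add: s0 spi e0 epi P_def Q_def sum_divide_distrib)
    also have "(\<Prod>k\<in>?K. e k) = (x - b * (P - Q)) ^ card G0 * (x + b * (P - Q)) ^ card Gpi"
      unfolding assms(5)[symmetric] using fin assms(6) by (simp add: prod.union_disjoint e0 epi)
    \<comment> \<open>Both classes are nonempty, so one factor of each kind can be reserved to clear
      the denominators of the last update.\<close>
    also have "\<dots> = (x - b * (P - Q)) ^ (card G0 - 1) * (x + b * (P - Q)) ^ (card Gpi - 1) *
        ((x - b * (P - Q)) * (x + b * (P - Q)))"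
      using fin assms(7,8)
      by (cases "card G0"; cases "card Gpi") auto
    finally have "poly (char_poly L) x = (\<Prod>k\<in>?K. (x - ev k) ^ (n k - 1)) *
        ((x - b * (P - Q)) ^ (card G0 - 1) * (x + b * (P - Q)) ^ (card Gpi - 1)) *
        ((x - b * (P - Q)) * (x + b * (P - Q)) *
          (1 + b * (P / (x - b * (P - Q)) + Q / (x + b * (P - Q)))))"
      by (simp only: mult_ac)
    \<comment> \<open>After clearing denominators, the constant term is -b^2 (P - Q)^2 + b^2 (P -
      Q)^2 = 0 and the linear coefficient is b (P + Q) = b N. This yields the simple entries 0 and
      -b N of the list.\<close>
    also have "(x - b * (P - Q)) * (x + b * (P - Q)) *
          (1 + b * (P / (x - b * (P - Q)) + Q / (x + b * (P - Q)))) = x * (x + b * real N)"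
    proof -
      have "y * z * (1 + b * (P / y + Q / z)) = y * z + b * (P * z + Q * y)"
        if "y \<noteq> 0" "z \<noteq> 0" for y z
        using that by (simp add: field_simps)
      from this[OF nz0 nzpi] show ?thesis
        by (simp add: N algebra_simps)
    qed
    also have "(\<Prod>k\<in>?K. (x - ev k) ^ (n k - 1)) *
        ((x - b * (P - Q)) ^ (card G0 - 1) * (x + b * (P - Q)) ^ (card Gpi - 1)) *
        (x * (x + b * real N)) = poly (\<Prod>r\<in>#?R. [:- r, 1:]) x"
      unfolding spectrum poly_prod_mset by (simp add: prod_mset_image_sum mult_ac)
    finally show ?thesis .
  qed
  have "char_poly L = (\<Prod>r\<in>#?R. [:- r, 1:])"
    by (rule poly_eqI_cofinite[of ?X, OF _ char_poly_L]) simp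
  then show ?thesis
    unfolding eigenvalue_mset_def L_def by (simp only: proots_prod_mset_linear_factors)
qed

end
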